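(* Let $k\geq 2$ be an integer. There exists a planar signed bipartite graph $[G,\Sigma]$ of unbalanced-girth $2k$ such that in $[G,\Sigma]^{(2k-2)}$ each part of the bipartition of $G$ induces a graph containing a clique of size at least $2^{2k-2}$.
   Context: A signature on a graph $G$ is a set $\Sigma\subseteq E(G)$ of edges declared negative. Re-signing at a vertex set $X$ changes the sign of every edge with exactly one end in $X$; two signatures are equivalent if one is obtained from the other by re-signing, and a signed graph $[G,\Sigma]$ is $G$ together with the class of signatures equivalent to $\Sigma$. A signed bipartite graph is a signed graph whose underlying graph is bipartite. A cycle is unbalanced if it has an odd number of negative edges; the unbalanced-girth is the length of a shortest unbalanced cycle. For a signed bipartite graph $[G,\Sigma]$ with bipartition $(X,Y)$ and an even integer $r\geq 2$, $[G,\Sigma]^{(r)}$ is the (unsigned) graph on $V(G)$ in which two distinct vertices $u,v$ are adjacent if and only if (i) $u$ and $v$ lie in the same part, and (ii) there are $u,v$-paths $P_1,P_2$ in $G$, each of length at most $r$, such that $P_1$ has an odd number of negative edges and $P_2$ has an even number of negative edges. *)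

theory Defs
  imports "HOL-Analysis.Analysis"
begin

text \<open>Finite simple graphs on natural-number vertices: a vertex set V and a set E of
  2-element subsets of V. A signature is a set of edges S \<subseteq> E (the negative edges).\<close>

definition simple_graph :: "nat set \<Rightarrow> nat set set \<Rightarrow> bool" where
  "simple_graph V E \<longleftrightarrow> finite V \<and> (\<forall>e\<in>E. e \<subseteq> V \<and> card e = 2)"

definition signature :: "nat set set \<Rightarrow> nat set set \<Rightarrow> bool" where
  "signature E S \<longleftrightarrow> S \<subseteq> E"

definition bipartition :: "nat set \<Rightarrow> nat set set \<Rightarrow> nat set \<Rightarrow> bool" where
  "bipartition V E X \<longleftrightarrow> X \<subseteq> V \<and> (\<forall>e\<in>E. card (e \<inter> X) = 1)"

definition planar :: "nat set \<Rightarrow> nat set set \<Rightarrow> bool" where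
  "planar V E \<longleftrightarrow> (\<exists>(pos :: nat \<Rightarrow> complex) (\<gamma> :: nat set \<Rightarrow> real \<Rightarrow> complex).
      inj_on pos V \<and>
      (\<forall>e\<in>E. arc (\<gamma> e) \<and> {pathstart (\<gamma> e), pathfinish (\<gamma> e)} = pos ` e \<and>
              path_image (\<gamma> e) \<inter> pos ` V = pos ` e) \<and>
      (\<forall>e\<in>E. \<forall>e'\<in>E. e \<noteq> e' \<longrightarrow>
              path_image (\<gamma> e) \<inter> path_image (\<gamma> e') \<subseteq> pos ` (e \<inter> e')))"

definition is_path :: "nat set set \<Rightarrow> nat list \<Rightarrow> bool" where
  "is_path E p \<longleftrightarrow> p \<noteq> [] \<and> distinct p \<and> (\<forall>i. Suc i < length p \<longrightarrow> {p ! i, p ! Suc i} \<in> E)"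

definition path_len :: "nat list \<Rightarrow> nat" where
  "path_len p = length p - 1"

definition path_neg :: "nat set set \<Rightarrow> nat list \<Rightarrow> nat" where
  "path_neg S p = card {i. Suc i < length p \<and> {p ! i, p ! Suc i} \<in> S}"

definition is_cycle :: "nat set set \<Rightarrow> nat list \<Rightarrow> bool" where
  "is_cycle E c \<longleftrightarrow> length c \<ge> 3 \<and> distinct c \<and>
     (\<forall>i < length c. {c ! i, c ! ((i + 1) mod length c)} \<in> E)"

definition cycle_neg :: "nat set set \<Rightarrow> nat list \<Rightarrow> nat" where
  "cycle_neg S c = card {i. i < length c \<and> {c ! i, c ! ((i + 1) mod length c)} \<in> S}"

definition unbalanced_cycle :: "nat set set \<Rightarrow> nat set set \<Rightarrow> nat list \<Rightarrow> bool" where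
  "unbalanced_cycle E S c \<longleftrightarrow> is_cycle E c \<and> odd (cycle_neg S c)"

definition unbalanced_girth_eq :: "nat set set \<Rightarrow> nat set set \<Rightarrow> nat \<Rightarrow> bool" where
  "unbalanced_girth_eq E S g \<longleftrightarrow>
     (\<exists>c. unbalanced_cycle E S c \<and> length c = g) \<and>
     (\<forall>c. unbalanced_cycle E S c \<longrightarrow> length c \<ge> g)"

definition power_adj :: "nat set \<Rightarrow> nat set set \<Rightarrow> nat set set \<Rightarrow> nat set \<Rightarrow> nat \<Rightarrow> nat \<Rightarrow> nat \<Rightarrow> bool" where
  "power_adj V E S X r u v \<longleftrightarrow> u \<in> V \<and> v \<in> V \<and> u \<noteq> v \<and> (u \<in> X \<longleftrightarrow> v \<in> X) \<and>
     (\<exists>P1 P2. is_path E P1 \<and> hd P1 = u \<and> last P1 = v \<and> path_len P1 \<le> r \<and> odd (path_neg S P1) \<and>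
              is_path E P2 \<and> hd P2 = u \<and> last P2 = v \<and> path_len P2 \<le> r \<and> even (path_neg S P2))"

definition power_clique :: "nat set \<Rightarrow> nat set set \<Rightarrow> nat set set \<Rightarrow> nat set \<Rightarrow> nat \<Rightarrow> nat set \<Rightarrow> nat \<Rightarrow> bool" where
  "power_clique V E S X r A m \<longleftrightarrow> (\<exists>K. K \<subseteq> A \<and> card K \<ge> m \<and>
     (\<forall>u\<in>K. \<forall>v\<in>K. u \<noteq> v \<longrightarrow> power_adj V E S X r u v))"

end

theory Submission
  imports Defs
begin

text \<open>
  Put N = 2k - 1 and label vertices by subsets of {0..N-1} so that a positive edge toggles one
  element and a negative edge complements the label. A closed walk with an odd number of negative
  edges then toggles every element, so its length is at least N + 1 = 2k.

  For a subset p of {0..j-1} let H(p) be a network with two ports, labelled p \<union> {j..N-1} (left)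
  and p (right). For j = N - 1 it is a single edge. Otherwise it consists of H(p \<union> {j}) and H(p),
  an edge joining the two left ports, an edge joining the two right ports, and a path of j + 1 edges,
  the first one negative, from the right port of the first network to the left port of the second.
  The graph is H({}) with its two ports joined by a negative edge. A leaf x of H(p) has positive walks
  of lengths m and N - j - m to the right and the left port of H(p), for some m, and the rest of the
  graph joins the ports by a negative walk of length j + 1. For leaves x, y of different halves of H(p),
  going through the two left ports or through the two right ports gives two positive walks of total
  length 2(N - j) \<le> 2N, and going through the inner or the outer negative walk gives two
  negative walks of total length 2N. So there are walks of both signs of length at most N, hence at
  most N - 1 = 2k - 2 if x and y lie in the same part, since N is odd. Shortcutting a walk
  of length less than 2k to a path does not change its sign. The 2^N leaves are split evenly
  between the parts.

  Placing the vertices of H(p) on consecutive integers, the two networks and the path between them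
  one after the other, draws the graph in a book with two pages.
\<close>

subsection \<open>Two-page drawings\<close>

text \<open>Parabolas rather than semicircles keep the intersection of two arcs a polynomial condition.\<close>

definition book_arc :: "real \<Rightarrow> nat \<Rightarrow> nat \<Rightarrow> real \<Rightarrow> complex" where
  "book_arc \<sigma> a b t = (let x = real a + t * (real b - real a)
     in Complex x (\<sigma> * ((x - real a) * (real b - x))))"

lemma book_arc_ends [simp]:
  "pathstart (book_arc \<sigma> a b) = of_nat a" "pathfinish (book_arc \<sigma> a b) = of_nat b"
  by (simp_all add: book_arc_def pathstart_def pathfinish_def complex_eq_iff)

lemma arc_book_arc:
  assumes "a < b" shows "arc (book_arc \<sigma> a b)"
proof -
  have "continuous_on {0..1} (book_arc \<sigma> a b)"
    unfolding book_arc_def Let_def Complex_eq by (intro continuous_intros)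
  moreover have "inj_on (book_arc \<sigma> a b) {0..1}"
    using assms by (auto simp: inj_on_def book_arc_def Let_def)
  ultimately show ?thesis by (simp add: arc_def path_def)
qed

lemma path_image_book_arc:
  assumes "a < b" "z \<in> path_image (book_arc \<sigma> a b)"
  shows "real a \<le> Re z" "Re z \<le> real b"
    "Im z = \<sigma> * ((Re z - real a) * (real b - Re z))"
proof -
  obtain t where t: "0 \<le> t" "t \<le> 1" "z = book_arc \<sigma> a b t"
    using assms(2) by (auto simp: path_image_def)
  have "t * (real b - real a) \<le> 1 * (real b - real a)"
    using t assms(1) by (intro mult_right_mono) auto
  then have "t * (real b - real a) \<le> real b - real a" by simp
  moreover have "Re z = real a + t * (real b - real a)"
    using t(3) by (simp add: book_arc_def Let_def)
  moreover have "0 \<le> t * (real b - real a)" using t assms(1) by simp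
  ultimately show "real a \<le> Re z" "Re z \<le> real b" by linarith+
  show "Im z = \<sigma> * ((Re z - real a) * (real b - Re z))"
    using t(3) by (simp add: book_arc_def Let_def)
qed

lemma book_arc_real_point:
  assumes "a < b" "\<sigma> \<noteq> 0" "z \<in> path_image (book_arc \<sigma> a b)" "Im z = 0"
  shows "z = of_nat a \<or> z = of_nat b"
  using path_image_book_arc[OF assms(1,3)] assms by (auto simp: complex_eq_iff)

text \<open>Inside the inner interval, widening to the outer one weakly increases each positive
  factor, so equal products force both factors, hence both ends, to agree.\<close>

lemma nested_parabolas:
  fixes a b c d x :: real
  assumes "a \<le> c" "d \<le> b" "c < x" "x < d" "(x - a) * (b - x) = (x - c) * (d - x)"
  shows "a = c \<and> b = d"
proof -
  have "(x - c) * (d - x) \<le> (x - a) * (d - x)" "(x - a) * (d - x) \<le> (x - a) * (b - x)"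
    using assms by (intro mult_right_mono mult_left_mono; simp)+
  then have "(x - c) * (d - x) = (x - a) * (d - x)" "(x - a) * (d - x) = (x - a) * (b - x)"
    using assms(5) by linarith+
  moreover have "d - x \<noteq> 0" "x - a \<noteq> 0" using assms(1,3,4) by auto
  ultimately have "x - c = x - a" "d - x = b - x"
    by (metis mult_right_cancel, metis mult_left_cancel)
  then show ?thesis by simp
qed

text \<open>Off the real axis a common point lies strictly inside both intervals, so these overlap;
  as they do not interleave, they are nested, and \<open>nested_parabolas\<close> makes them
  equal.\<close>

lemma book_arcs_same_page:
  assumes ab: "a < b" and cd: "c < d" and ne: "(a, b) \<noteq> (c, d)" and \<sigma>: "\<sigma> \<noteq> 0"
    and cross: "\<not> (a < c \<and> c < b \<and> b < d)" "\<not> (c < a \<and> a < d \<and> d < b)"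
    and z: "z \<in> path_image (book_arc \<sigma> a b)" "z \<in> path_image (book_arc \<sigma> c d)"
  shows "Im z = 0"
proof (rule ccontr)
  assume "Im z \<noteq> 0"
  note 1 = path_image_book_arc[OF ab z(1)] and 2 = path_image_book_arc[OF cd z(2)]
  have lt: "real a < Re z" "Re z < real b" "real c < Re z" "Re z < real d"
    using 1 2 \<open>Im z \<noteq> 0\<close> by (auto simp: order.strict_iff_order)
  have eq: "(Re z - real a) * (real b - Re z) = (Re z - real c) * (real d - Re z)"
    using 1(3) 2(3) \<sigma> by simp
  have "a < d" "c < b" using lt by linarith+
  then have "a \<le> c \<and> d \<le> b \<or> c \<le> a \<and> b \<le> d" using cross by linarith
  then show False
    using nested_parabolas[of a c d b "Re z"] nested_parabolas[of c a b d "Re z"] lt eq ne by auto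
qed

text \<open>\<open>U\<close> selects the arcs drawn above the axis. Arcs on opposite pages have
  imaginary parts of opposite sign, and arcs on one page do not interleave, so two arcs meet only on
  the axis, where each contains just its ends.\<close>

lemma two_page_planar:
  fixes R :: "(nat \<times> nat) set"
  assumes lt: "\<And>a b. (a, b) \<in> R \<Longrightarrow> a < b \<and> a \<in> V \<and> b \<in> V"
    and cross: "\<And>a b c d. (a, b) \<in> R \<Longrightarrow> (c, d) \<in> R \<Longrightarrow> a < c \<Longrightarrow> c < b \<Longrightarrow> b < d \<Longrightarrow>
      ((a, b) \<in> U) \<noteq> ((c, d) \<in> U)"
  shows "planar V ((\<lambda>(a, b). {a, b}) ` R)"
proof -
  define \<sigma> :: "nat \<times> nat \<Rightarrow> real" where "\<sigma> p = (if p \<in> U then 1 else - 1)" for p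
  \<comment> \<open>Edges are unordered; \<open>Min\<close> and \<open>Max\<close> recover the left
    and the right end.\<close>
  define \<gamma> where "\<gamma> e = book_arc (\<sigma> (Min e, Max e)) (Min e) (Max e)" for e
  have \<gamma>: "\<gamma> {a, b} = book_arc (\<sigma> (a, b)) a b" if "(a, b) \<in> R" for a b
    using lt[OF that] by (simp add: \<gamma>_def)
  have nz: "\<sigma> p \<noteq> 0" for p by (simp add: \<sigma>_def)
  have real: "z \<in> {of_nat a, of_nat b}"
    if "(a, b) \<in> R" "z \<in> path_image (book_arc (\<sigma> (a, b)) a b)" "Im z = 0" for a b z
    using book_arc_real_point[of a b "\<sigma> (a, b)" z] lt[OF that(1)] nz that by auto
  have ends: "of_nat a \<in> path_image (book_arc s a b)" "of_nat b \<in> path_image (book_arc s a b)"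
    for s a b
    using pathstart_in_path_image[of "book_arc s a b"] pathfinish_in_path_image[of "book_arc s a b"]
    by simp_all
  have edge: "arc (\<gamma> e) \<and> {pathstart (\<gamma> e), pathfinish (\<gamma> e)} = of_nat ` e \<and>
      path_image (\<gamma> e) \<inter> of_nat ` V = of_nat ` e"
    if e: "e \<in> (\<lambda>(a, b). {a, b}) ` R" for e
  proof -
    obtain a b where ab: "(a, b) \<in> R" "e = {a, b}" using e by auto
    have "z \<in> of_nat ` e" if "z \<in> path_image (\<gamma> e)" "z \<in> of_nat ` V" for z
      using real[OF ab(1), of z] that ab \<gamma>[OF ab(1)] by auto
    moreover have "of_nat ` e \<subseteq> path_image (\<gamma> e) \<inter> of_nat ` V"
      using ends lt[OF ab(1)] ab \<gamma>[OF ab(1)] by auto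
    ultimately have "path_image (\<gamma> e) \<inter> of_nat ` V = of_nat ` e" by blast
    then show ?thesis using ab \<gamma>[OF ab(1)] lt[OF ab(1)] arc_book_arc by auto
  qed
  have disj: "path_image (\<gamma> e) \<inter> path_image (\<gamma> e') \<subseteq> of_nat ` (e \<inter> e')"
    if e: "e \<in> (\<lambda>(a, b). {a, b}) ` R" "e' \<in> (\<lambda>(a, b). {a, b}) ` R" "e \<noteq> e'" for e e'
  proof
    fix z assume "z \<in> path_image (\<gamma> e) \<inter> path_image (\<gamma> e')"
    moreover obtain a b where ab: "(a, b) \<in> R" "e = {a, b}" using e by auto
    moreover obtain c d where cd: "(c, d) \<in> R" "e' = {c, d}" using e by auto
    ultimately have z: "z \<in> path_image (book_arc (\<sigma> (a, b)) a b)"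
      "z \<in> path_image (book_arc (\<sigma> (c, d)) c d)" using \<gamma> by auto
    have l: "a < b" "c < d" using lt ab cd by auto
    have "Im z = 0"
    proof (cases "\<sigma> (a, b) = \<sigma> (c, d)")
      case True
      then have "\<not> (a < c \<and> c < b \<and> b < d)" "\<not> (c < a \<and> a < d \<and> d < b)"
        using cross[OF ab(1) cd(1)] cross[OF cd(1) ab(1)] by (auto simp: \<sigma>_def split: if_splits)
      then show ?thesis
        using book_arcs_same_page[OF l _ nz] z True ab cd e(3) by auto
    next
      case False
      then have "\<sigma> (a, b) = - \<sigma> (c, d)" by (auto simp: \<sigma>_def split: if_splits)
      moreover define P where "P = (Re z - real a) * (real b - Re z)"
      moreover define Q where "Q = (Re z - real c) * (real d - Re z)"
      ultimately have "Im z = \<sigma> (a, b) * P" "Im z = - \<sigma> (a, b) * Q" "0 \<le> P" "0 \<le> Q"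
        using path_image_book_arc[OF l(1) z(1)] path_image_book_arc[OF l(2) z(2)] by auto
      then show ?thesis unfolding \<sigma>_def by (cases "(a, b) \<in> U") auto
    qed
    then have "z \<in> of_nat ` e" "z \<in> of_nat ` e'"
      using real[OF ab(1) z(1)] real[OF cd(1) z(2)] ab cd by auto
    then show "z \<in> of_nat ` (e \<inter> e')" by (auto simp: image_iff)
  qed
  show ?thesis
    unfolding planar_def
    by (rule exI[of _ of_nat], rule exI[of _ \<gamma>]) (use edge disj in \<open>auto simp: inj_on_def\<close>)
qed

subsection \<open>Signed walks and labellings by subsets\<close>

text \<open>The last two arguments are the length and whether the number of negative edges, with
  repetition, is odd. Vertices may repeat, so walks concatenate freely; they become paths only at
  the end.\<close>

inductive swalk :: "nat set set \<Rightarrow> nat set set \<Rightarrow> nat \<Rightarrow> nat \<Rightarrow> nat \<Rightarrow> bool \<Rightarrow> bool"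
  for E S where
  refl: "swalk E S u u 0 False"
| step: "{u, w} \<in> E \<Longrightarrow> swalk E S w v l g \<Longrightarrow> swalk E S u v (Suc l) (g \<noteq> ({u, w} \<in> S))"

lemma swalk_edge: "{u, v} \<in> E \<Longrightarrow> ({u, v} \<in> S) = g \<Longrightarrow> swalk E S u v 1 g"
  using swalk.step[of u v E S v 0 False] swalk.refl[of E S v] by simp

lemma swalk_trans:
  "swalk E S u v l g \<Longrightarrow> swalk E S v w l' g' \<Longrightarrow> swalk E S u w (l + l') (g \<noteq> g')"
proof (induction rule: swalk.induct)
  case (step u x v l g)
  have "swalk E S u w (Suc (l + l')) ((g \<noteq> g') \<noteq> ({u, x} \<in> S))"
    using step.hyps(1) step.IH step.prems swalk.step by blast
  then show ?case by (cases g; cases g') simp_all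
qed simp

lemma swalk_sym: "swalk E S u v l g \<Longrightarrow> swalk E S v u l g"
proof (induction rule: swalk.induct)
  case (step u w v l g)
  have "swalk E S w u 1 ({u, w} \<in> S)"
    using step.hyps(1) by (intro swalk_edge) (auto simp: insert_commute)
  from swalk_trans[OF step.IH this] show ?case by simp
qed (rule swalk.refl)

section \<open>Vertex lists as signed walks, and shortening walks to paths\<close>

lemma path_neg_Cons:
  "path_neg S (x # y # p) = (if {x, y} \<in> S then 1 else 0) + path_neg S (y # p)"
proof -
  let ?A = "{i. Suc i < length (y # p) \<and> {(y # p) ! i, (y # p) ! Suc i} \<in> S}"
  have "{i. Suc i < length (x # y # p) \<and> {(x # y # p) ! i, (x # y # p) ! Suc i} \<in> S}
      = (if {x, y} \<in> S then {0} else {}) \<union> Suc ` ?A" (is "?L = ?R")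
  proof (intro set_eqI)
    fix i show "i \<in> ?L \<longleftrightarrow> i \<in> ?R" by (cases i) (auto simp: image_iff)
  qed
  moreover have "finite ?A" by (rule finite_subset[of _ "{..<length (y # p)}"]) auto
  ultimately show ?thesis
    by (simp add: path_neg_def card_image card_Un_disjoint)
qed

lemma path_neg_single [simp]: "path_neg S [x] = 0"
  by (simp add: path_neg_def)

lemma all_nat_split: "(\<forall>i. Q i) \<longleftrightarrow> Q 0 \<and> (\<forall>i. Q (Suc i))" for Q :: "nat \<Rightarrow> bool"
  by (metis not0_implies_Suc)

lemma is_path_Cons_iff:
  "is_path E (x # y # p) \<longleftrightarrow> {x, y} \<in> E \<and> x \<notin> set (y # p) \<and> is_path E (y # p)"
proof -
  have "(\<forall>i. Suc i < length (x # y # p) \<longrightarrow> {(x # y # p) ! i, (x # y # p) ! Suc i} \<in> E) \<longleftrightarrow>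
      {x, y} \<in> E \<and> (\<forall>i. Suc i < length (y # p) \<longrightarrow> {(y # p) ! i, (y # p) ! Suc i} \<in> E)"
    (is "(\<forall>i. ?Q i) \<longleftrightarrow> _")
    by (subst all_nat_split[of ?Q]) simp
  then show ?thesis by (auto simp: is_path_def)
qed

lemma swalk_of_list:
  assumes "p \<noteq> []" "\<And>i. Suc i < length p \<Longrightarrow> {p ! i, p ! Suc i} \<in> E"
  shows "swalk E S (hd p) (last p) (path_len p) (odd (path_neg S p))"
  using assms
proof (induction p rule: induct_list012)
  case (3 x y p)
  have "{x, y} \<in> E" using "3.prems"(2)[of 0] by simp
  moreover have "swalk E S y (last (y # p)) (length p) (odd (path_neg S (y # p)))"
    using "3.IH"(2) "3.prems"(2)[of "Suc _"] by (simp add: path_len_def)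
  ultimately show ?case
    using swalk.step[of x y E S "last (y # p)" "length p" "odd (path_neg S (y # p))"]
    by (cases "{x, y} \<in> S") (simp_all add: path_neg_Cons path_len_def)
qed (auto simp: path_len_def intro: swalk.refl)

lemma path_neg_append:
  "path_neg S (p @ x # q) = path_neg S (p @ [x]) + path_neg S (x # q)"
proof (induction p rule: induct_list012)
  case (3 a b p)
  then show ?case by (simp only: append_Cons path_neg_Cons add.assoc)
qed (simp_all add: path_neg_Cons)

text \<open>Repeating the first vertex makes the cyclic edges consecutive, so that a cycle can be
  read as a closed walk.\<close>

lemma cycle_neg_eq_path_neg:
  assumes "c \<noteq> []" shows "cycle_neg S c = path_neg S (c @ [hd c])"
proof -
  have "{c ! i, c ! ((i + 1) mod length c)} = {(c @ [hd c]) ! i, (c @ [hd c]) ! Suc i}"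
    if "i < length c" for i
    using that assms by (cases "Suc i = length c") (auto simp: nth_append hd_conv_nth)
  then show ?thesis
    unfolding cycle_neg_def path_neg_def by (intro arg_cong[of _ _ card]) auto
qed

text \<open>Vertices are added at the front one by one. If the new vertex already occurs, the loop
  it closes has length at most \<open>m\<close>, so it is positive by \<open>closed\<close>, and
  cutting it off keeps the sign.\<close>

lemma swalk_imp_path:
  assumes closed: "\<And>u l. swalk E S u u l True \<Longrightarrow> m < l"
    and "swalk E S u v l g" "l \<le> m"
  shows "\<exists>p. is_path E p \<and> hd p = u \<and> last p = v \<and> path_len p \<le> l \<and> odd (path_neg S p) = g"
  using assms(2,3)
proof (induction rule: swalk.induct)
  case (refl u)
  then show ?case by (intro exI[of _ "[u]"]) (simp add: is_path_def path_len_def)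
next
  case (step u w v l g)
  then obtain p where p: "is_path E p" "hd p = w" "last p = v" "path_len p \<le> l"
    "odd (path_neg S p) = g" by auto
  obtain q where q: "p = w # q" using p by (cases p) (auto simp: is_path_def)
  show ?case
  proof (cases "u \<in> set p")
    case False
    then show ?thesis
      using p q step.hyps(1)
      by (intro exI[of _ "u # p"]) (auto simp: is_path_Cons_iff path_neg_Cons path_len_def)
  next
    case True
    then obtain p1 p2 where split: "p = p1 @ u # p2" by (meson split_list)
    have edges: "{p ! i, p ! Suc i} \<in> E" if "Suc i < length p" for i
      using p(1) that by (auto simp: is_path_def)
    have "{(p1 @ [u]) ! i, (p1 @ [u]) ! Suc i} \<in> E" if "Suc i < length (p1 @ [u])" for i
      using edges[of i] that unfolding split
      by (cases "Suc i = length p1") (auto simp: nth_append)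
    then have "swalk E S w u (length p1) (odd (path_neg S (p1 @ [u])))"
      using swalk_of_list[of "p1 @ [u]" E S] p(2) split
      by (cases p1) (auto simp: path_len_def)
    \<comment> \<open>The loop is the new edge followed by \<open>p1\<close> back to
      \<open>u\<close>; \<open>u # p2\<close> survives.\<close>
    from swalk.step[OF step.hyps(1) this]
    have "swalk E S u u (Suc (length p1)) (odd (path_neg S (p1 @ [u])) \<noteq> ({u, w} \<in> S))" .
    then have "odd (path_neg S (p1 @ [u])) = ({u, w} \<in> S)"
      using closed[of u "Suc (length p1)"] p(4) step.prems split
      by (cases "odd (path_neg S (p1 @ [u])) = ({u, w} \<in> S)") (auto simp: path_len_def)
    moreover have "{(u # p2) ! i, (u # p2) ! Suc i} \<in> E" if "Suc i < length (u # p2)" for i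
      using edges[of "length p1 + i"] that unfolding split by (simp add: nth_append)
    then have "is_path E (u # p2)"
      using p(1) unfolding split is_path_def by simp
    ultimately show ?thesis
      using p split path_neg_append[of S p1 u p2]
      by (intro exI[of _ "u # p2"]) (auto simp: path_len_def)
  qed
qed

text \<open>Such a labelling is a homomorphism to the folded cube: the N-dimensional hypercube with
  antipodal points joined by negative edges.\<close>

locale cube_labelling =
  fixes N :: nat and E S :: "nat set set" and \<phi> :: "nat \<Rightarrow> nat set"
  assumes odd_N: "odd N"
    and label_subset: "\<phi> v \<subseteq> {..<N}"
    and pos_edge: "{u, v} \<in> E \<Longrightarrow> {u, v} \<notin> S \<Longrightarrow> \<exists>x. sym_diff (\<phi> u) (\<phi> v) = {x}"
    and neg_edge: "{u, v} \<in> E \<Longrightarrow> {u, v} \<in> S \<Longrightarrow> \<phi> u = {..<N} - \<phi> v"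
begin

lemma finite_label [simp]: "finite (\<phi> v)"
  by (rule finite_subset[OF label_subset]) simp

text \<open>A negative edge complements both sides of the comparison and leaves the symmetric
  difference alone; a positive edge changes its size by at most one. The extra 1 pays for the
  negative edge that an odd walk must contain.\<close>

lemma swalk_length_ge:
  "swalk E S u v l g \<Longrightarrow>
    card (sym_diff (\<phi> u) (if g then {..<N} - \<phi> v else \<phi> v)) + (if g then 1 else 0) \<le> l"
proof (induction rule: swalk.induct)
  case (step u w v l g)
  let ?T = "\<lambda>g. if g then {..<N} - \<phi> v else \<phi> v"
  show ?case
  proof (cases "{u, w} \<in> S")
    case True
    have "sym_diff (\<phi> u) (?T (\<not> g)) = sym_diff (\<phi> w) (?T g)"
      using neg_edge[OF step.hyps(1) True] label_subset[of w] label_subset[of v] by auto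
    then show ?thesis using step.IH True by (cases g) simp_all
  next
    case False
    then obtain x where x: "sym_diff (\<phi> u) (\<phi> w) = {x}" using pos_edge step.hyps(1) by blast
    have fin: "finite (?T g)" by simp
    have "sym_diff (\<phi> u) (?T g) \<subseteq> insert x (sym_diff (\<phi> w) (?T g))" using x by blast
    then have "card (sym_diff (\<phi> u) (?T g)) \<le> card (insert x (sym_diff (\<phi> w) (?T g)))"
      using fin by (intro card_mono) auto
    also have "\<dots> \<le> Suc (card (sym_diff (\<phi> w) (?T g)))" by (rule card_insert_le_m1) simp_all
    finally show ?thesis using step.IH False by (cases g) simp_all
  qed
qed simp

lemma unbalanced_closed_length:
  assumes "swalk E S u u l True" shows "N < l"
proof -
  have "sym_diff (\<phi> u) ({..<N} - \<phi> u) = {..<N}" using label_subset[of u] by auto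
  then show ?thesis using swalk_length_ge[OF assms] by simp
qed

text \<open>Complementing replaces a size c by N - c, which has the other parity because N is odd.
  Hence the parity of the label size gives the bipartition.\<close>

lemma edge_parity:
  assumes "{u, v} \<in> E" shows "even (card (\<phi> u)) \<noteq> even (card (\<phi> v))"
proof (cases "{u, v} \<in> S")
  case True
  have "card (\<phi> u) + card (\<phi> v) = N"
    using neg_edge[OF assms True] label_subset[of v] card_mono[OF _ label_subset[of v]]
    by (simp add: card_Diff_subset)
  then show ?thesis using odd_N by presburger
next
  case False
  obtain x where "sym_diff (\<phi> u) (\<phi> v) = {x}" using pos_edge[OF assms False] by blast
  then have "\<phi> u = insert x (\<phi> v) \<and> x \<notin> \<phi> v \<or> \<phi> v = insert x (\<phi> u) \<and> x \<notin> \<phi> u"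
    unfolding set_eq_iff Un_iff Diff_iff insert_iff by (metis empty_iff)
  then have "card (\<phi> u) = Suc (card (\<phi> v)) \<or> card (\<phi> v) = Suc (card (\<phi> u))"
    by (metis card_insert_disjoint finite_label)
  then show ?thesis by auto
qed

lemma swalk_parity:
  "swalk E S u v l g \<Longrightarrow> even l \<longleftrightarrow> even (card (\<phi> u)) = even (card (\<phi> v))"
proof (induction rule: swalk.induct)
  case (step u w v l g)
  then show ?case using edge_parity[OF step.hyps(1)] by auto
qed simp

end

subsection \<open>The recursive network\<close>

text \<open>A network of depth d on {s..s + net_len N d} is H(p) for a set p \<subseteq> {0..j-1}, j = N - Suc d; its ports are
  the two end points. The third component of an edge says whether it is negative.\<close>

fun net_len :: "nat \<Rightarrow> nat \<Rightarrow> nat" where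
  "net_len N 0 = 1"
| "net_len N (Suc d) = net_len N d + (N - Suc d) + net_len N d"

fun net :: "nat \<Rightarrow> nat \<Rightarrow> nat \<Rightarrow> (nat \<times> nat \<times> bool) set" where
  "net N 0 s = {(s, Suc s, False)}"
| "net N (Suc d) s = (let a = s + net_len N d; b = a + (N - Suc d); t = b + net_len N d in
     net N d s \<union> net N d b \<union> {(i, Suc i, i = a) | i. a \<le> i \<and> i < b} \<union>
     {(s, b, False), (a, t, False)})"

text \<open>The ends of the bottom-level edges; both cliques are taken from them.\<close>

fun net_leaves :: "nat \<Rightarrow> nat \<Rightarrow> nat \<Rightarrow> nat set" where
  "net_leaves N 0 s = {s, Suc s}"
| "net_leaves N (Suc d) s = net_leaves N d s \<union> net_leaves N d (s + net_len N d + (N - Suc d))"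

text \<open>At each level only the edge between the left ports and the edge between the right ports
  interleave, so it is enough to lift the former.\<close>

fun upper_page :: "nat \<Rightarrow> nat \<Rightarrow> nat \<Rightarrow> (nat \<times> nat) set" where
  "upper_page N 0 s = {}"
| "upper_page N (Suc d) s = (let b = s + net_len N d + (N - Suc d) in
     insert (s, b) (upper_page N d s \<union> upper_page N d b))"

lemma net_len_pos [simp]: "0 < net_len N d"
  by (induction d) auto

text \<open>Recursion in terms of named ports: \<open>s\<close>, \<open>a\<close> belong to the
  first half, \<open>b\<close>, \<open>t\<close> to the second, and \<open>s\<close>,
  \<open>t\<close> to the whole.\<close>

lemma net_Suc:
  assumes "a = s + net_len N d" "b = a + (N - Suc d)" "t = b + net_len N d"
  shows "net N (Suc d) s = net N d s \<union> net N d b \<union> {(i, Suc i, i = a) | i. a \<le> i \<and> i < b} \<union>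
      {(s, b, False), (a, t, False)}"
    "net_leaves N (Suc d) s = net_leaves N d s \<union> net_leaves N d b"
    "upper_page N (Suc d) s = insert (s, b) (upper_page N d s \<union> upper_page N d b)"
    "s + net_len N (Suc d) = t"
  unfolding assms by (simp_all only: net.simps net_leaves.simps upper_page.simps net_len.simps Let_def add.assoc)

declare net_len.simps(2) [simp del] net.simps(2) [simp del] net_leaves.simps(2) [simp del]
  upper_page.simps(2) [simp del]

lemma net_bounds: "(x, y, g) \<in> net N d s \<Longrightarrow> s \<le> x \<and> x < y \<and> y \<le> s + net_len N d"
proof (induction d arbitrary: s)
  case (Suc d)
  define a where "a = s + net_len N d"
  define b where "b = a + (N - Suc d)"
  define t where "t = b + net_len N d"
  note net = net_Suc[OF a_def b_def t_def]
  have "s < a" "a \<le> b" "b < t" by (simp_all add: a_def b_def t_def)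
  then show ?case
    using Suc.IH[of s, folded a_def] Suc.IH[of b, folded t_def] Suc.prems unfolding net by auto
qed simp

lemma net_leaves_bounds: "x \<in> net_leaves N d s \<Longrightarrow> s \<le> x \<and> x \<le> s + net_len N d"
proof (induction d arbitrary: s)
  case (Suc d)
  define a where "a = s + net_len N d"
  define b where "b = a + (N - Suc d)"
  define t where "t = b + net_len N d"
  note net = net_Suc[OF a_def b_def t_def]
  have "s < a" "a \<le> b" "b < t" by (simp_all add: a_def b_def t_def)
  then show ?case
    using Suc.IH[of s, folded a_def] Suc.IH[of b, folded t_def] Suc.prems unfolding net by auto
qed auto

lemma upper_page_bounds:
  "(x, y) \<in> upper_page N d s \<Longrightarrow> s \<le> x \<and> x < y \<and> y < s + net_len N d"
proof (induction d arbitrary: s)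
  case (Suc d)
  define a where "a = s + net_len N d"
  define b where "b = a + (N - Suc d)"
  define t where "t = b + net_len N d"
  note net = net_Suc[OF a_def b_def t_def]
  have "s < a" "a \<le> b" "b < t" by (simp_all add: a_def b_def t_def)
  then show ?case
    using Suc.IH[of s, folded a_def] Suc.IH[of b, folded t_def] Suc.prems unfolding net by auto
qed simp

text \<open>The halves occupy the disjoint intervals from \<open>s\<close> to \<open>a\<close> and
  from \<open>b\<close> to \<open>t\<close>, so interleaving edges lie in one half, or are
  \<open>(s, b)\<close> and \<open>(a, t)\<close>, which are on different pages.\<close>

lemma net_page_crossing:
  assumes "d < N" "(x, y, g) \<in> net N d s" "(x', y', g') \<in> net N d s" "x < x'" "x' < y" "y < y'"
  shows "((x, y) \<in> upper_page N d s) \<noteq> ((x', y') \<in> upper_page N d s)"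
  using assms
proof (induction d arbitrary: s)
  case (Suc d)
  define a where "a = s + net_len N d"
  define b where "b = a + (N - Suc d)"
  define t where "t = b + net_len N d"
  have lt: "s < a" "a < b" "b < t" using Suc.prems(1) net_len_pos[of N d]
    unfolding a_def b_def t_def by linarith+
  have dN: "d < N" using Suc.prems(1) by simp
  note net = net_Suc(1)[OF a_def b_def t_def] and up = net_Suc(3)[OF a_def b_def t_def]
  note nb = net_bounds[of _ _ _ N d s, folded a_def] net_bounds[of _ _ _ N d b, folded t_def]
  note ub = upper_page_bounds[of _ _ N d s, folded a_def]
    upper_page_bounds[of _ _ N d b, folded t_def]
  \<comment> \<open>Each case also records that the page of an edge inside a half is decided by that
    half, as the induction hypothesis requires.\<close>
  have cases: "(u, v, h) \<in> net N d s \<and> s \<le> u \<and> v \<le> a \<and>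
        ((u, v) \<in> upper_page N (Suc d) s \<longleftrightarrow> (u, v) \<in> upper_page N d s)
      \<or> (u, v, h) \<in> net N d b \<and> b \<le> u \<and> v \<le> t \<and>
        ((u, v) \<in> upper_page N (Suc d) s \<longleftrightarrow> (u, v) \<in> upper_page N d b)
      \<or> v = Suc u
      \<or> u = s \<and> v = b \<and> (u, v) \<in> upper_page N (Suc d) s
      \<or> u = a \<and> v = t \<and> (u, v) \<notin> upper_page N (Suc d) s"
    if "(u, v, h) \<in> net N (Suc d) s" for u v h
  proof -
    from that consider "(u, v, h) \<in> net N d s" | "(u, v, h) \<in> net N d b" | "v = Suc u"
      | "u = s" "v = b" | "u = a" "v = t" unfolding net by auto
    then show ?thesis
    proof cases
      case 1
      then show ?thesis using nb(1)[OF 1] lt ub(2)[of u v] by (auto simp: up)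
    next
      case 2
      then show ?thesis using nb(2)[OF 2] lt ub(1)[of u v] by (auto simp: up)
    next
      case 5
      then show ?thesis using lt ub[of u v] by (auto simp: up)
    qed (auto simp: up)
  qed
  have IH: "((x, y) \<in> upper_page N d r) \<noteq> ((x', y') \<in> upper_page N d r)"
    if "(x, y, g) \<in> net N d r" "(x', y', g') \<in> net N d r" for r
    using Suc.IH[OF dN that] Suc.prems(4-6) by simp
  from cases[OF Suc.prems(2)] cases[OF Suc.prems(3)] show ?case
    by (elim disjE conjE)
      ((use Suc.prems(4-6) lt in linarith) | (use IH[of s] in blast) | (use IH[of b] in blast) | blast)+
qed auto

text \<open>The halves are labelled from \<open>insert j p\<close> and \<open>p\<close>, so each
  edge between ports toggles just j. The complement of \<open>insert j p\<close> agrees with the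
  label of \<open>b\<close> from j upwards, so the middle path needs its negative edge and j
  toggles.\<close>

lemma net_labelling:
  assumes "d < N" "p \<subseteq> {..<N - Suc d}"
  shows "\<exists>\<phi>. (\<forall>v. \<phi> v \<subseteq> {..<N}) \<and> \<phi> s = p \<union> {N - Suc d..<N} \<and> \<phi> (s + net_len N d) = p \<and>
    (\<forall>x y g. (x, y, g) \<in> net N d s \<longrightarrow>
      (if g then \<phi> x = {..<N} - \<phi> y else \<exists>z. sym_diff (\<phi> x) (\<phi> y) = {z}))"
  using assms
proof (induction d arbitrary: p s)
  case 0
  define \<phi> where "\<phi> v = (if v = s then insert (N - 1) p else p)" for v
  have N: "{N - Suc 0..<N} = {N - 1}" "N - 1 \<notin> p" "N - 1 < N" "p \<subseteq> {..<N}" using 0 by auto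
  have vals: "\<phi> s = insert (N - 1) p" "\<phi> (Suc s) = p" by (simp_all add: \<phi>_def)
  have sub: "\<forall>v. \<phi> v \<subseteq> {..<N}" using N(3,4) by (simp add: \<phi>_def)
  have "sym_diff (\<phi> s) (\<phi> (Suc s)) = {N - 1}" unfolding vals using N(2) by auto
  then show ?case
    using sub vals N(1) by (intro exI[of _ \<phi>]) simp
next
  case (Suc d)
  define j where "j = N - Suc (Suc d)"
  define a where "a = s + net_len N d"
  define b where "b = a + (N - Suc d)"
  define t where "t = b + net_len N d"
  note net = net_Suc[OF a_def b_def t_def]
  have dN: "d < N" and j: "N - Suc d = Suc j" "b = a + Suc j" "Suc j < N" and p: "p \<subseteq> {..<j}"
    using Suc.prems by (auto simp: j_def b_def)
  have "insert j p \<subseteq> {..<N - Suc d}" "p \<subseteq> {..<N - Suc d}" using p j by auto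
  then obtain \<phi>1 \<phi>2 where \<phi>1: "\<And>v. \<phi>1 v \<subseteq> {..<N}" "\<phi>1 s = insert j p \<union> {Suc j..<N}"
      "\<phi>1 a = insert j p"
      "\<And>x y g. (x, y, g) \<in> net N d s \<Longrightarrow>
        (if g then \<phi>1 x = {..<N} - \<phi>1 y else \<exists>z. sym_diff (\<phi>1 x) (\<phi>1 y) = {z})"
    and \<phi>2: "\<And>v. \<phi>2 v \<subseteq> {..<N}" "\<phi>2 b = p \<union> {Suc j..<N}" "\<phi>2 t = p"
      "\<And>x y g. (x, y, g) \<in> net N d b \<Longrightarrow>
        (if g then \<phi>2 x = {..<N} - \<phi>2 y else \<exists>z. sym_diff (\<phi>2 x) (\<phi>2 y) = {z})"
    using Suc.IH[OF dN, of "insert j p" s] Suc.IH[OF dN, of p b] unfolding j(1) a_def t_def by metis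
  \<comment> \<open>labels of the middle path: after the complementing edge, the elements below j are restored to p
    one by one\<close>
  define W where "W i = {x \<in> p. Suc x < i} \<union> {x. i \<le> Suc x \<and> x < j \<and> x \<notin> p} \<union> {Suc j..<N}" for i
  define \<phi> where "\<phi> v = (if v \<le> a then \<phi>1 v else if v < b then W (v - a) else \<phi>2 v)" for v
  have "s < a" "a < b" "b < t" by (simp_all add: a_def t_def j)
  have left: "\<phi> v = \<phi>1 v" if "v \<le> a" for v using that by (simp add: \<phi>_def)
  have right: "\<phi> v = \<phi>2 v" if "b \<le> v" for v using that \<open>a < b\<close> by (simp add: \<phi>_def)
  \<comment> \<open>The path labels end at the label that the second half gives to \<open>b\<close>,
    so \<open>mid\<close> also covers the last edge of the path.\<close>
  have "W (Suc j) = p \<union> {Suc j..<N}" using p by (auto simp: W_def)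
  then have mid: "\<phi> v = W (v - a)" if "a < v" "v \<le> b" for v
    using that \<phi>2(2) j(2) by (cases "v = b") (auto simp: \<phi>_def)
  have "W i \<subseteq> {..<N}" for i using p j by (auto simp: W_def)
  then have sub: "\<phi> v \<subseteq> {..<N}" for v using \<phi>1(1) \<phi>2(1) by (simp add: \<phi>_def)
  have jN: "{Suc j..<N} \<inter> insert j p = {}" "{j..<N} = insert j {Suc j..<N}" using p j by auto
  have ends: "\<phi> s = p \<union> {j..<N}" "\<phi> a = insert j p" "\<phi> b = p \<union> {Suc j..<N}" "\<phi> t = p"
    using \<phi>1(2,3) \<phi>2(2,3) left[of s] left[of a] right[of b] right[of t] \<open>s < a\<close> \<open>b < t\<close> jN
    by simp_all
  have "j \<notin> p" using p by auto
  have edges: "if g then \<phi> x = {..<N} - \<phi> y else \<exists>z. sym_diff (\<phi> x) (\<phi> y) = {z}"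
    if "(x, y, g) \<in> net N (Suc d) s" for x y g
  proof -
    from that consider "(x, y, g) \<in> net N d s" | "(x, y, g) \<in> net N d b"
      | "x = a" "y = Suc a" "g" | "a < x" "x < b" "y = Suc x" "\<not> g"
      | "x = s" "y = b" "\<not> g" | "x = a" "y = t" "\<not> g" unfolding net by auto
    then show ?thesis
    proof cases
      case 1
      then show ?thesis using \<phi>1(4) net_bounds[OF 1, folded a_def] left[of x] left[of y] by simp
    next
      case 2
      then show ?thesis using \<phi>2(4) net_bounds[OF 2, folded t_def] right[of x] right[of y] by simp
    next
      case 3
      have "\<phi> (Suc a) = W 1" using mid[of "Suc a"] \<open>a < b\<close> by simp
      moreover have "insert j p = {..<N} - W 1"
        using p Suc_lessD[OF j(3)] by (auto simp: W_def)
      ultimately show ?thesis using 3 ends(2) by simp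
    next
      case 4
      define z where "z = x - Suc a"
      have "sym_diff (W (Suc z)) (W (Suc (Suc z))) = {z}" if "z < j"
        using that by (auto simp: W_def)
      moreover have "x - a = Suc z" "y - a = Suc (Suc z)" "z < j"
        using 4 j by (auto simp: z_def)
      ultimately show ?thesis using 4 mid[of x] mid[of y] by auto
    next
      case 5
      have "sym_diff (\<phi> s) (\<phi> b) = {j}" unfolding ends jN(2) using \<open>j \<notin> p\<close> by auto
      then have "\<exists>z. sym_diff (\<phi> x) (\<phi> y) = {z}" unfolding 5(1,2) ..
      then show ?thesis using 5(3) by (simp only: if_False)
    next
      case 6
      have "sym_diff (\<phi> a) (\<phi> t) = {j}" unfolding ends using \<open>j \<notin> p\<close> by auto
      then have "\<exists>z. sym_diff (\<phi> x) (\<phi> y) = {z}" unfolding 6(1,2) ..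
      then show ?thesis using 6(3) by (simp only: if_False)
    qed
  qed
  show ?case
    unfolding net(4) j_def[symmetric]
    by (intro exI[of _ \<phi>] conjI allI impI) (rule sub ends edges | assumption)+
qed

section \<open>Leaves of the network and short walks between them\<close>

lemma finite_net_leaves [simp]: "finite (net_leaves N d s)"
  by (rule finite_subset[of _ "{s..s + net_len N d}"]) (use net_leaves_bounds in auto)

text \<open>Each of the \<open>2 ^ d\<close> bottom-level edges has exactly one end in
  \<open>X\<close>. Since \<open>X\<close> is any set separating the ends of all edges, this serves
  both parts.\<close>

lemma card_net_leaves_part:
  assumes "d < N" "\<And>x y g. (x, y, g) \<in> net N d s \<Longrightarrow> (x \<in> X) \<noteq> (y \<in> X)"
  shows "card (net_leaves N d s \<inter> X) = 2 ^ d"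
  using assms
proof (induction d arbitrary: s)
  case 0
  have "(s \<in> X) \<noteq> (Suc s \<in> X)" using "0.prems"(2)[of s "Suc s" False] by simp
  then show ?case by (cases "s \<in> X") simp_all
next
  case (Suc d)
  define a where "a = s + net_len N d"
  define b where "b = a + (N - Suc d)"
  define t where "t = b + net_len N d"
  note net = net_Suc[OF a_def b_def t_def]
  have dN: "d < N" and "a < b" using Suc.prems(1) by (simp_all add: b_def)
  have "net_leaves N d s \<inter> net_leaves N d b = {}"
    using net_leaves_bounds[of _ N d s] net_leaves_bounds[of _ N d b] \<open>a < b\<close>
    unfolding a_def[symmetric] by fastforce
  then have "card (net_leaves N (Suc d) s \<inter> X) =
      card (net_leaves N d s \<inter> X) + card (net_leaves N d b \<inter> X)"
    unfolding net(2) Int_Un_distrib2 by (intro card_Un_disjoint) auto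
  also have "\<dots> = 2 ^ Suc d"
  proof -
    have sub: "net N d s \<subseteq> net N (Suc d) s" "net N d b \<subseteq> net N (Suc d) s"
      unfolding net(1) by blast+
    have "card (net_leaves N d s \<inter> X) = 2 ^ d"
      by (rule Suc.IH[OF dN]) (rule Suc.prems(2), rule subsetD[OF sub(1)])
    moreover have "card (net_leaves N d b \<inter> X) = 2 ^ d"
      by (rule Suc.IH[OF dN]) (rule Suc.prems(2), rule subsetD[OF sub(2)])
    ultimately show ?thesis by simp
  qed
  finally show ?case .
qed

text \<open>The ambient graph may have further edges, so that walks between leaves of a subnetwork
  can leave it.\<close>

definition realises :: "nat set set \<Rightarrow> nat set set \<Rightarrow> (nat \<times> nat \<times> bool) set \<Rightarrow> bool" where
  "realises E S R \<longleftrightarrow> (\<forall>(x, y, g) \<in> R. {x, y} \<in> E \<and> ({x, y} \<in> S) = g)"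

lemma realises_swalk:
  assumes "realises E S R" "(x, y, g) \<in> R"
  shows "swalk E S x y 1 g" "swalk E S y x 1 g"
proof -
  show "swalk E S x y 1 g" using assms by (intro swalk_edge) (auto simp: realises_def)
  then show "swalk E S y x 1 g" by (rule swalk_sym)
qed

lemma realises_net_Suc:
  assumes "realises E S (net N (Suc d) s)"
    and "a = s + net_len N d" "b = a + (N - Suc d)" "t = b + net_len N d"
  shows "realises E S (net N d s)" "realises E S (net N d b)"
    "swalk E S s b 1 False" "swalk E S a t 1 False"
proof -
  note net = net_Suc(1)[OF assms(2-4)]
  show "realises E S (net N d s)" "realises E S (net N d b)"
    using assms(1) unfolding realises_def net by blast+
  show "swalk E S s b 1 False" "swalk E S a t 1 False"
    by (rule realises_swalk(1)[OF assms(1)], simp add: net)+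
qed

lemma net_middle_swalk:
  assumes "realises E S (net N (Suc d) s)" "Suc d < N"
    and "a = s + net_len N d" "b = a + (N - Suc d)" "t = b + net_len N d"
  shows "swalk E S a b (N - Suc d) True"
proof -
  note net = net_Suc(1)[OF assms(3-5)]
  have "a < b" using assms(2,4) by simp
  have "a + Suc i \<le> b \<Longrightarrow> swalk E S a (a + Suc i) (Suc i) True" for i
  proof (induction i)
    case 0
    have "(a, Suc a, True) \<in> net N (Suc d) s" using 0 by (auto simp: net)
    then show ?case using realises_swalk(1)[OF assms(1)] by simp
  next
    case (Suc i)
    have "(a + Suc i, Suc (a + Suc i), False) \<in> net N (Suc d) s" using Suc.prems by (auto simp: net)
    then have "swalk E S (a + Suc i) (Suc (a + Suc i)) 1 False"
      by (rule realises_swalk(1)[OF assms(1)])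
    from swalk_trans[OF Suc.IH this] show ?case using Suc.prems by simp
  qed
  moreover obtain i where "N - Suc d = Suc i" using assms(2) by (metis Suc_diff_Suc)
  ultimately show ?thesis unfolding assms(4) by simp
qed

text \<open>One level up, a leaf of the first half keeps its left port and reaches the new right
  port by one more edge; for the second half it is the other way round. So the two lengths always
  add up to \<open>Suc d\<close>.\<close>

lemma net_leaf_swalks:
  assumes "realises E S (net N d s)" "x \<in> net_leaves N d s"
  shows "\<exists>m\<le>Suc d. swalk E S x (s + net_len N d) m False \<and> swalk E S x s (Suc d - m) False"
  using assms
proof (induction d arbitrary: s)
  case 0
  have "(s, Suc s, False) \<in> net N 0 s" by simp
  note e = realises_swalk[OF "0.prems"(1) this]
  show ?case
  proof (cases "x = s")
    case True
    then show ?thesis using e(1) swalk.refl by (intro exI[of _ 1]) simp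
  next
    case False
    then show ?thesis using e(2) swalk.refl "0.prems"(2) by (intro exI[of _ 0]) simp
  qed
next
  case (Suc d)
  define a where "a = s + net_len N d"
  define b where "b = a + (N - Suc d)"
  define t where "t = b + net_len N d"
  note net = net_Suc[OF a_def b_def t_def]
  note R = realises_net_Suc[OF Suc.prems(1) a_def b_def t_def]
  from Suc.prems(2) consider "x \<in> net_leaves N d s" | "x \<in> net_leaves N d b" unfolding net by auto
  then show ?case
  proof cases
    case 1
    then obtain m where "m \<le> Suc d" "swalk E S x a m False" "swalk E S x s (Suc d - m) False"
      using Suc.IH[OF R(1)] unfolding a_def by blast
    then show ?thesis
      using swalk_trans[OF _ R(4), of x m False] unfolding net(4)
      by (intro exI[of _ "Suc m"]) simp
  next
    case 2
    then obtain m where "m \<le> Suc d" "swalk E S x t m False" "swalk E S x b (Suc d - m) False"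
      using Suc.IH[OF R(2)] unfolding t_def by blast
    then show ?thesis
      using swalk_trans[OF _ swalk_sym[OF R(3)], of x "Suc d - m" False] unfolding net(4)
      by (intro exI[of _ m]) (simp add: Suc_diff_le)
  qed
qed

text \<open>The negative walk between the ports stands for the rest of the graph and is carried
  along the induction. Leaves of one half are handled by recursion, leaves of different halves by
  four explicit walks.\<close>

lemma net_leaves_swalks:
  assumes "realises E S (net N d s)" "d < N" "odd N"
    and "swalk E S s (s + net_len N d) (N - d) True"
    and "x \<in> net_leaves N d s" "y \<in> net_leaves N d s" "x \<noteq> y"
    and "\<And>l g. swalk E S x y l g \<Longrightarrow> even l"
  shows "\<exists>l<N. swalk E S x y l g"
  using assms
proof (induction d arbitrary: s)
  case 0
  have "(s, Suc s, False) \<in> net N 0 s" by simp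
  note realises_swalk[OF "0.prems"(1) this]
  \<comment> \<open>Two distinct leaves of a single edge are joined by a walk of odd length, against
    the evenness hypothesis.\<close>
  then have "swalk E S x y 1 False" using "0.prems"(5-7) by auto
  then show ?case using "0.prems"(8) by fastforce
next
  case (Suc d)
  define a where "a = s + net_len N d"
  define b where "b = a + (N - Suc d)"
  define t where "t = b + net_len N d"
  note net = net_Suc[OF a_def b_def t_def]
  note R = realises_net_Suc[OF Suc.prems(1) a_def b_def t_def]
  note mid = net_middle_swalk[OF Suc.prems(1,2) a_def b_def t_def]
  have dN: "d < N" using Suc.prems(2) by simp
  have outer: "swalk E S s t (N - Suc d) True" using Suc.prems(4) unfolding net(4) .
  \<comment> \<open>Going back along one edge between ports turns the outer walk into one between
    the ports of a half, longer by one, as the smaller depth demands.\<close>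
  have outer_a: "swalk E S s (s + net_len N d) (N - d) True"
    using swalk_trans[OF outer swalk_sym[OF R(4)]] Suc.prems(2) by (simp add: a_def Suc_diff_Suc)
  have outer_b: "swalk E S b (b + net_len N d) (N - d) True"
    using swalk_trans[OF swalk_sym[OF R(3)] outer] Suc.prems(2) by (simp add: t_def Suc_diff_Suc)
  have across: "\<exists>l<N. swalk E S u v l g"
    if u: "u \<in> net_leaves N d s" and v: "v \<in> net_leaves N d b"
      and ev: "\<And>l g. swalk E S u v l g \<Longrightarrow> even l" for u v
  proof -
    obtain m where m: "m \<le> Suc d" "swalk E S u a m False" "swalk E S u s (Suc d - m) False"
      using net_leaf_swalks[OF R(1) u] unfolding a_def by blast
    obtain n where n: "n \<le> Suc d" "swalk E S v t n False" "swalk E S v b (Suc d - n) False"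
      using net_leaf_swalks[OF R(2) v] unfolding t_def by blast
    note v' = swalk_sym[OF n(2)] swalk_sym[OF n(3)]
    \<comment> \<open>The two positive lengths add up to \<open>2 * Suc d + 2\<close>, at most 2N,
      and the two negative ones to exactly 2N, so each sign has a walk of length at most N.\<close>
    have w: "swalk E S u v (m + 1 + n) False" "swalk E S u v (Suc d - m + 1 + (Suc d - n)) False"
      "swalk E S u v (m + (N - Suc d) + (Suc d - n)) True"
      "swalk E S u v (Suc d - m + (N - Suc d) + n) True"
      using swalk_trans[OF swalk_trans[OF m(2) R(4)] v'(1)]
        swalk_trans[OF swalk_trans[OF m(3) R(3)] v'(2)]
        swalk_trans[OF swalk_trans[OF m(2) mid] v'(2)]
        swalk_trans[OF swalk_trans[OF m(3) outer] v'(1)] by simp_all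
    \<comment> \<open>Length N itself is excluded: N is odd and the walk is even.\<close>
    have less: "l < N" if "l \<le> N" "swalk E S u v l h" for l h
      using that ev Suc.prems(3) by (cases "l = N") auto
    show ?thesis
    proof (cases g)
      case True
      have "m + (N - Suc d) + (Suc d - n) \<le> N \<or> Suc d - m + (N - Suc d) + n \<le> N"
        using m(1) n(1) dN by linarith
      then show ?thesis using less w(3,4) True by auto
    next
      case False
      have "m + 1 + n \<le> N \<or> Suc d - m + 1 + (Suc d - n) \<le> N"
        using m(1) n(1) Suc.prems(2) by linarith
      then show ?thesis using less w(1,2) False by auto
    qed
  qed
  from Suc.prems(5,6) consider "x \<in> net_leaves N d s" "y \<in> net_leaves N d s"
    | "x \<in> net_leaves N d b" "y \<in> net_leaves N d b"
    | "x \<in> net_leaves N d s" "y \<in> net_leaves N d b"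
    | "x \<in> net_leaves N d b" "y \<in> net_leaves N d s" unfolding net by auto
  then show ?case
  proof cases
    case 1
    show ?thesis by (rule Suc.IH[OF R(1) dN Suc.prems(3) outer_a 1 Suc.prems(7,8)])
  next
    case 2
    show ?thesis by (rule Suc.IH[OF R(2) dN Suc.prems(3) outer_b 2 Suc.prems(7,8)])
  next
    case 3
    show ?thesis by (rule across[OF 3 Suc.prems(8)])
  next
    case 4
    have "\<exists>l<N. swalk E S y x l g" using across[OF 4(2,1)] Suc.prems(8) swalk_sym by metis
    then show ?thesis using swalk_sym by blast
  qed
qed

section \<open>Short paths and the unbalanced girth in a labelled graph\<close>

context cube_labelling
begin

lemma short_swalk_path:
  assumes "swalk E S u v l g" "l \<le> N"
  shows "\<exists>p. is_path E p \<and> hd p = u \<and> last p = v \<and> path_len p \<le> l \<and> odd (path_neg S p) = g"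
  by (rule swalk_imp_path[OF unbalanced_closed_length assms])

lemma unbalanced_cycle_length:
  assumes "unbalanced_cycle E S c" shows "N < length c"
proof -
  let ?c = "c @ [hd c]"
  have c: "c \<noteq> []" "odd (cycle_neg S c)"
    "\<And>i. i < length c \<Longrightarrow> {c ! i, c ! ((i + 1) mod length c)} \<in> E"
    using assms by (auto simp: unbalanced_cycle_def is_cycle_def)
  have "{?c ! i, ?c ! Suc i} \<in> E" if "Suc i < length ?c" for i
    using c(3)[of i] that c(1)
    by (cases "Suc i = length c") (simp_all add: nth_append hd_conv_nth)
  then have "swalk E S (hd ?c) (last ?c) (path_len ?c) (odd (path_neg S ?c))"
    by (intro swalk_of_list) auto
  then have "swalk E S (hd c) (hd c) (length c) True"
    using c(1,2) cycle_neg_eq_path_neg[of c S] by (simp add: path_len_def)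
  then show ?thesis by (rule unbalanced_closed_length)
qed

text \<open>Shorten the positive walk to a path. With the negative edge it closes to an unbalanced
  walk, which is longer than N; so the path has exactly N edges and the cycle attains the lower
  bound.\<close>

lemma unbalanced_girth:
  assumes "{s, t} \<in> E" "{s, t} \<in> S" "swalk E S s t N False" "2 \<le> N"
  shows "unbalanced_girth_eq E S (N + 1)"
proof -
  obtain p where p: "is_path E p" "hd p = s" "last p = t" "path_len p \<le> N" "even (path_neg S p)"
    using short_swalk_path[OF assms(3)] by auto
  have ne: "p \<noteq> []" and edges: "\<And>i. Suc i < length p \<Longrightarrow> {p ! i, p ! Suc i} \<in> E"
    using p(1) by (auto simp: is_path_def)
  have ts: "{t, s} \<in> E" "{t, s} \<in> S" using assms(1,2) by (simp_all add: insert_commute)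
  have "swalk E S s t (path_len p) False"
    using swalk_of_list[OF ne edges, of S] p by simp
  from swalk_trans[OF this swalk_edge[OF ts(1), of S True]] have "N < path_len p + 1"
    using ts(2) unbalanced_closed_length by simp
  then have len: "length p = N + 1" using p(4) ne by (simp add: path_len_def)
  have "{p ! i, p ! ((i + 1) mod length p)} \<in> E" if "i < length p" for i
  proof (cases "Suc i = length p")
    case True
    then have "p ! i = t" using p(3) ne last_conv_nth[of p] by (metis diff_Suc_1)
    then show ?thesis using True ts(1) p(2) ne by (simp add: hd_conv_nth)
  next
    case False
    then show ?thesis using that edges[of i] by simp
  qed
  then have "is_cycle E p"
    using p(1) len assms(4) by (auto simp: is_cycle_def is_path_def)
  moreover have "cycle_neg S p = path_neg S p + 1"
  proof -
    have "p = butlast p @ [t]" using ne p(3) append_butlast_last_id by metis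
    then have "path_neg S (p @ [s]) = path_neg S p + path_neg S [t, s]"
      using path_neg_append[of S "butlast p" t "[s]"] by (metis append.assoc append_Cons append_Nil)
    then show ?thesis using cycle_neg_eq_path_neg[OF ne, of S] p(2) ts(2) by (simp add: path_neg_Cons)
  qed
  ultimately have "unbalanced_cycle E S p" using p(5) by (simp add: unbalanced_cycle_def)
  then show ?thesis
    unfolding unbalanced_girth_eq_def using len unbalanced_cycle_length by fastforce
qed

end

subsection \<open>Both parts contain large cliques\<close>

lemma power_cliqueI:
  assumes "K \<subseteq> A" "n \<le> card K"
    and "\<And>u v. u \<in> K \<Longrightarrow> v \<in> K \<Longrightarrow> u \<noteq> v \<Longrightarrow> power_adj V E S X r u v"
  shows "power_clique V E S X r A n"
  using assms unfolding power_clique_def by blast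

theorem theorem5:
  fixes k :: nat
  assumes "k \<ge> 2"
  shows "\<exists>V E S X. simple_graph V E \<and> signature E S \<and> planar V E \<and> bipartition V E X \<and>
           unbalanced_girth_eq E S (2 * k) \<and>
           power_clique V E S X (2 * k - 2) X (2 ^ (2 * k - 2)) \<and>
           power_clique V E S X (2 * k - 2) (V - X) (2 ^ (2 * k - 2))"
proof -
  define N where "N = 2 * k - 1"
  \<comment> \<open>With \<open>d = N - 1\<close> the index j is 0, so \<open>p = {}\<close> and the
    ports are labelled by the full and the empty set.\<close>
  define d where "d = 2 * k - 2"
  define L where "L = net_len N d"
  define R where "R = insert (0, L, True) (net N d 0)"
  define P where "P = (\<lambda>(x, y, g). (x, y)) ` R"
  define E where "E = (\<lambda>(x, y). {x, y}) ` P"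
  define S where "S = {{x, y} | x y. (x, y, True) \<in> R}"
  define V where "V = {..L}"
  have N: "odd N" "3 \<le> N" "d < N" "N - Suc d = 0" "N - d = 1" "2 * k = N + 1"
    using assms by (auto simp: N_def d_def)
  have R_bounds: "x < y \<and> y \<le> L" if "(x, y, g) \<in> R" for x y g
    using that net_bounds[of x y g N d 0] by (auto simp: R_def L_def)
  have E: "e \<in> E \<longleftrightarrow> (\<exists>x y g. e = {x, y} \<and> (x, y, g) \<in> R)" for e
    by (force simp: E_def P_def)
  then have E_I: "{x, y} \<in> E" if "(x, y, g) \<in> R" for x y g
    using that by blast

  obtain \<phi> where \<phi>: "\<And>v. \<phi> v \<subseteq> {..<N}" "\<phi> 0 = {0..<N}" "\<phi> L = {}"
      "\<And>x y g. (x, y, g) \<in> net N d 0 \<Longrightarrow>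
        (if g then \<phi> x = {..<N} - \<phi> y else \<exists>z. sym_diff (\<phi> x) (\<phi> y) = {z})"
    using net_labelling[OF N(3), of "{}" 0] unfolding N(4) L_def by auto
  \<comment> \<open>The added edge from 0 to \<open>L\<close> joins complementary labels.\<close>
  have neg: "\<phi> x = {..<N} - \<phi> y" if "(x, y, True) \<in> R" for x y
    using that \<phi>(2,3) \<phi>(4)[of x y True] by (auto simp: R_def atLeast0LessThan)
  have pos: "\<exists>z. sym_diff (\<phi> x) (\<phi> y) = {z}" if "(x, y, False) \<in> R" for x y
    using that \<phi>(4)[of x y False] by (auto simp: R_def)
  have S_neg: "\<phi> x = {..<N} - \<phi> y" if "{x, y} \<in> S" for x y
  proof -
    from that consider "(x, y, True) \<in> R" | "(y, x, True) \<in> R"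
      by (auto simp: S_def doubleton_eq_iff)
    then show ?thesis
    proof cases
      case 2
      then show ?thesis using neg[OF 2] \<phi>(1)[of x] by auto
    qed (rule neg)
  qed
  \<comment> \<open>As \<open>S\<close> consists of unordered pairs, no pair may come from both a
    positive and a negative triple: the labels would differ in one element and in N > 1
    elements.\<close>
  have S_iff: "{x, y} \<in> S \<longleftrightarrow> g" if xyg: "(x, y, g) \<in> R" for x y g
  proof (cases g)
    case False
    have "{x, y} \<notin> S"
    proof
      assume "{x, y} \<in> S"
      then have "sym_diff (\<phi> x) (\<phi> y) = {..<N}" using S_neg[of x y] \<phi>(1)[of y] by auto
      moreover obtain z where "sym_diff (\<phi> x) (\<phi> y) = {z}" using pos[of x y] xyg False by auto
      ultimately have "card {..<N} = card {z}" by simp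
      then show False using N(2) by simp
    qed
    then show ?thesis using False by simp
  qed (use that in \<open>auto simp: S_def\<close>)

  interpret cube_labelling N E S \<phi>
  proof
    fix u v assume uv: "{u, v} \<in> E" "{u, v} \<notin> S"
    then obtain x y g where xy: "{u, v} = {x, y}" "(x, y, g) \<in> R" unfolding E by blast
    then have "\<not> g" using uv(2) S_iff[OF xy(2)] by simp
    then consider "(u, v, False) \<in> R" | "(v, u, False) \<in> R"
      using xy by (auto simp: doubleton_eq_iff)
    then show "\<exists>x. sym_diff (\<phi> u) (\<phi> v) = {x}"
    proof cases
      case 2
      then show ?thesis using pos[OF 2] by (simp add: Un_commute)
    qed (rule pos)
  qed (use N(1) \<phi>(1) S_neg in auto)

  define X where "X = {v \<in> V. even (card (\<phi> v))}"
  have parts: "(x \<in> X) \<noteq> (y \<in> X)" if "(x, y, g) \<in> R" for x y g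
    using edge_parity[of x y] R_bounds[OF that] E_I[OF that] by (auto simp: X_def V_def)
  have net_parts: "(x \<in> X) \<noteq> (y \<in> X)" if "(x, y, g) \<in> net N d 0" for x y g
    using parts[of x y g] that by (simp add: R_def)
  have card_leaves: "card (net_leaves N d 0 \<inter> X) = 2 ^ d" "card (net_leaves N d 0 \<inter> - X) = 2 ^ d"
    by (rule card_net_leaves_part[OF N(3)], use net_parts in blast)+
  have realises: "realises E S (net N d 0)" "realises E S R"
    using S_iff E_I unfolding realises_def R_def by blast+

  have "simple_graph V E"
    unfolding simple_graph_def
  proof (intro conjI ballI)
    fix e assume "e \<in> E"
    then obtain x y g where xy: "e = {x, y}" "(x, y, g) \<in> R" unfolding E by blast
    show "e \<subseteq> V" "card e = 2" using R_bounds[OF xy(2)] by (auto simp: xy(1) V_def)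
  qed (simp add: V_def)
  moreover have "signature E S"
    using E_I by (auto simp: signature_def S_def)
  moreover have "planar V E"
    unfolding E_def
  proof (rule two_page_planar)
    show "x < y \<and> x \<in> V \<and> y \<in> V" if "(x, y) \<in> P" for x y
      using that R_bounds by (fastforce simp: P_def V_def)
  next
    fix x y x' y' assume *: "(x, y) \<in> P" "(x', y') \<in> P" "x < x'" "x' < y" "y < y'"
    then obtain g g' where "(x, y, g) \<in> R" "(x', y', g') \<in> R" by (auto simp: P_def)
    \<comment> \<open>The edge from 0 to \<open>L\<close> spans all vertices and interleaves with no
      edge, so only network edges remain.\<close>
    moreover from this have "y < L" "0 < x'" using * R_bounds by fastforce+
    ultimately have "(x, y, g) \<in> net N d 0" "(x', y', g') \<in> net N d 0"
      by (auto simp: R_def)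
    then show "((x, y) \<in> upper_page N d 0) \<noteq> ((x', y') \<in> upper_page N d 0)"
      by (rule net_page_crossing[OF N(3) _ _ *(3-5)])
  qed
  moreover have "bipartition V E X"
    unfolding bipartition_def
  proof (intro conjI ballI)
    fix e assume "e \<in> E"
    then obtain x y g where xy: "e = {x, y}" "(x, y, g) \<in> R" unfolding E by blast
    then show "card (e \<inter> X) = 1" using parts[OF xy(2)] by (cases "x \<in> X") auto
  qed (auto simp: X_def)
  moreover have outer: "swalk E S 0 L 1 True"
    by (rule realises_swalk(1)[OF realises(2)]) (simp add: R_def)
  have "unbalanced_girth_eq E S (2 * k)"
  proof -
    have "(0, L, True) \<in> R" by (simp add: R_def)
    then have "{0, L} \<in> E" "{0, L} \<in> S" using S_iff E_I by auto
    moreover have "swalk E S 0 L N False"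
    proof -
      \<comment> \<open>The two walks from any leaf to the ports join to a positive walk of length
        \<open>Suc d = N\<close>.\<close>
      have "net_leaves N d 0 \<noteq> {}"
        using card_leaves(1) by auto
      then obtain x where "x \<in> net_leaves N d 0" by blast
      then obtain m where m: "m \<le> Suc d" "swalk E S x L m False" "swalk E S x 0 (Suc d - m) False"
        using net_leaf_swalks[OF realises(1)] unfolding L_def by force
      have "Suc d - m + m = N" using m(1) N(3,4) by simp
      then show ?thesis using swalk_trans[OF swalk_sym[OF m(3)] m(2)] by simp
    qed
    ultimately show ?thesis using unbalanced_girth N(2,6) by simp
  qed
  moreover have adj: "power_adj V E S X (2 * k - 2) u v"
    if uv: "u \<in> net_leaves N d 0" "v \<in> net_leaves N d 0" "u \<noteq> v" "u \<in> X \<longleftrightarrow> v \<in> X" for u v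
  proof -
    have V: "u \<in> V" "v \<in> V" using uv net_leaves_bounds[of _ N d 0] by (auto simp: V_def L_def)
    have even: "even l" if "swalk E S u v l g" for l g
      using swalk_parity[OF that] uv(4) V by (simp add: X_def)
    have "\<exists>p. is_path E p \<and> hd p = u \<and> last p = v \<and> path_len p \<le> 2 * k - 2 \<and>
        odd (path_neg S p) = g" for g
    proof -
      \<comment> \<open>At the outermost level the rest of the graph is the single negative edge, of
        length \<open>N - d = 1\<close>.\<close>
      have "swalk E S 0 (0 + net_len N d) (N - d) True"
        using outer N(5) by (simp add: L_def)
      then have "\<exists>l<N. swalk E S u v l g"
        by (rule net_leaves_swalks[OF realises(1) N(3,1) _ uv(1-3)]) (rule even)
      then obtain l where "l < N" "swalk E S u v l g" by blast
      then show ?thesis using short_swalk_path[of u v l g] N(6) by fastforce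
    qed
    from this[of True] this[of False] show ?thesis
      unfolding power_adj_def using uv V by auto
  qed
  have "power_clique V E S X (2 * k - 2) X (2 ^ (2 * k - 2))"
    by (rule power_cliqueI[of "net_leaves N d 0 \<inter> X"]) (use card_leaves(1) adj in \<open>auto simp: d_def\<close>)
  moreover have "power_clique V E S X (2 * k - 2) (V - X) (2 ^ (2 * k - 2))"
  proof (rule power_cliqueI)
    show "net_leaves N d 0 \<inter> - X \<subseteq> V - X"
      using net_leaves_bounds[of _ N d 0] by (auto simp: V_def L_def)
    show "2 ^ (2 * k - 2) \<le> card (net_leaves N d 0 \<inter> - X)"
      using card_leaves(2) by (simp add: d_def)
  qed (use adj in auto)
  ultimately show ?thesis by blast
qed

end
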